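(* Let $\mathbf{L}$ be any logic between $\mathbf{B}$ and $\mathbf{RM}$. Then quantifier elimination fails for DOAG (divisible ordered abelian groups) in $\mathbf{L}$: there is a formula $A$ in the language of DOAG such that for no quantifier-free formula $B$ in that language do we have $\mathrm{DOAG}\vDash_{\mathbf{L}} A\leftrightarrow B$.
   Context: Language: first-order formulas built with $\neg,\land,\lor,\rightarrow,\forall,\exists,\bot,\top$ and the logical predicate $=$. $A\leftrightarrow B$ abbreviates $(A\rightarrow B)\land(B\rightarrow A)$. A $\mathbf{B}$-frame is $\langle W,R,{}^*,s\rangle$ with $W\neq\varnothing$, $R\subseteq W^3$, ${}^*:W\to W$, $s\in W$, such that for all $\alpha,\beta,\gamma,\delta\in W$: $Rs\alpha\alpha$; $Rs\alpha\beta$ and $R\beta\gamma\delta$ imply $R\alpha\gamma\delta$; $\alpha^{**}=\alpha$; $Rs\alpha\beta$ implies $Rs\beta^*\alpha^*$. A $\mathbf{B}$-model $M=\langle W,R,D,{}^*,s,V\rangle$ adds a nonempty set $D$ and a valuation $V$ with $V(w,P)\subseteq D^n$ for each $w\in W$ and $n$-ary predicate $P$, such that $Rs\alpha\beta$ implies $V(\alpha,P)\subseteq V(\beta,P)$; function and constant symbols are interpreted on $D$ independently of worlds; $=$ is interpreted as real identity on $D$ at every world. Truth at a world $w$ under an assignment $\overline{a}$ of elements of $D$ to variables: atomic formulas according to $V(w,\cdot)$; $\top$ always, $\bot$ never; $\land,\lor$ as usual at $w$; $M,w\vDash\neg A[\overline a]$ iff $M,w^*\nvDash A[\overline a]$;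 $M,w\vDash (A\rightarrow B)[\overline a]$ iff for all $w_1,w_2$ with $Rww_1w_2$, $M,w_1\vDash A[\overline a]$ implies $M,w_2\vDash B[\overline a]$; $\forall x$, $\exists x$ range over $D$ at $w$. A formula with free variables holds at $w$ in $M$ (without assignment) if it holds under all assignments. An $\mathbf{RM}$-frame is a $\mathbf{B}$-frame such that for all $\alpha,\beta,\gamma,\delta$: $R\alpha\beta\gamma$ implies $R\alpha\gamma^*\beta^*$; $R\alpha\beta\gamma$ implies $R\beta\alpha\gamma$; $R\alpha\alpha\alpha$; if there is $x$ with $R\alpha\beta x$ and $Rx\gamma\delta$ then there is $y$ with $R\alpha y\delta$ and $R\beta\gamma y$; $R\alpha\beta\gamma$ implies $Rs\alpha\gamma$ or $Rs\beta\gamma$. A logic $\mathbf{L}$ extending $\mathbf{B}$ is given by a class of $\mathbf{B}$-frames ($\mathbf{L}$-frames); $\mathbf{L}$-models are the $\mathbf{B}$-models on $\mathbf{L}$-frames. $\mathbf{L}$ lies between $\mathbf{B}$ and $\mathbf{RM}$ if every $\mathbf{RM}$-frame is an $\mathbf{L}$-frame. $\Gamma\vDash_{\mathbf{L}}A$ means: for every $\mathbf{L}$-model $M$, if $M,s\vDash\Gamma$ then $M,s\vDash A$. DOAG, in the signature with binary predicate $<$, unary function $-$, binary function $+$, constant $0$, has the axioms: $\forall x(x<x\rightarrow\bot)$; $\forall x,y(x=y\lor x<y\lor y<x)$; $\forall x,y,z((x<y\land y<z)\rightarrow x<z)$; $\forall x,y,z(x<y\rightarrow x+z<y+z)$; for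 each $n>1$, $\forall y\exists x(\underbrace{x+\dots+x}_{n\text{ times}}=y)$; $\forall x,y,z((x+y)+z=x+(y+z))$; $\forall x(x+0=x)$; $\forall x(x+(-x)=0)$; $\forall x,y(x+y=y+x)$. A theory $T$ admits quantifier elimination in $\mathbf{L}$ if for every formula $A$ there is a quantifier-free formula $B$ with $T\vDash_{\mathbf{L}}A\leftrightarrow B$. *)

theory Defs
  imports Main "HOL-Library.FuncSet" "HOL-Library.Infinite_Typeclass"
begin

text \<open>Constants are function symbols of arity 0. Identity is a logical symbol, not one of the
  predicate symbols of the signature.\<close>

record ('f, 'p) signature =
  fun_arity :: "'f \<Rightarrow> nat"
  pred_arity :: "'p \<Rightarrow> nat"

datatype 'f tm = Var nat | App 'f "'f tm list"

datatype ('f, 'p) fm =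
    Pred 'p "'f tm list"
  | Eql "'f tm" "'f tm"
  | Top
  | Bot
  | Neg "('f, 'p) fm"
  | Conj "('f, 'p) fm" "('f, 'p) fm"
  | Disj "('f, 'p) fm" "('f, 'p) fm"
  | Imp "('f, 'p) fm" "('f, 'p) fm"
  | Forall nat "('f, 'p) fm"
  | Exists nat "('f, 'p) fm"

definition Iff :: "('f, 'p) fm \<Rightarrow> ('f, 'p) fm \<Rightarrow> ('f, 'p) fm" where
  "Iff A B = Conj (Imp A B) (Imp B A)"

primrec wf_tm :: "('f, 'p) signature \<Rightarrow> 'f tm \<Rightarrow> bool" where
  "wf_tm S (Var x) \<longleftrightarrow> True"
| "wf_tm S (App f ts) \<longleftrightarrow> length ts = fun_arity S f \<and> list_all (wf_tm S) ts"

primrec wf_fm :: "('f, 'p) signature \<Rightarrow> ('f, 'p) fm \<Rightarrow> bool" where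
  "wf_fm S (Pred P ts) \<longleftrightarrow> length ts = pred_arity S P \<and> list_all (wf_tm S) ts"
| "wf_fm S (Eql t u) \<longleftrightarrow> wf_tm S t \<and> wf_tm S u"
| "wf_fm S Top \<longleftrightarrow> True"
| "wf_fm S Bot \<longleftrightarrow> True"
| "wf_fm S (Neg A) \<longleftrightarrow> wf_fm S A"
| "wf_fm S (Conj A B) \<longleftrightarrow> wf_fm S A \<and> wf_fm S B"
| "wf_fm S (Disj A B) \<longleftrightarrow> wf_fm S A \<and> wf_fm S B"
| "wf_fm S (Imp A B) \<longleftrightarrow> wf_fm S A \<and> wf_fm S B"
| "wf_fm S (Forall x A) \<longleftrightarrow> wf_fm S A"
| "wf_fm S (Exists x A) \<longleftrightarrow> wf_fm S A"

primrec quantifier_free :: "('f, 'p) fm \<Rightarrow> bool" where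
  "quantifier_free (Pred P ts) \<longleftrightarrow> True"
| "quantifier_free (Eql t u) \<longleftrightarrow> True"
| "quantifier_free Top \<longleftrightarrow> True"
| "quantifier_free Bot \<longleftrightarrow> True"
| "quantifier_free (Neg A) \<longleftrightarrow> quantifier_free A"
| "quantifier_free (Conj A B) \<longleftrightarrow> quantifier_free A \<and> quantifier_free B"
| "quantifier_free (Disj A B) \<longleftrightarrow> quantifier_free A \<and> quantifier_free B"
| "quantifier_free (Imp A B) \<longleftrightarrow> quantifier_free A \<and> quantifier_free B"
| "quantifier_free (Forall x A) \<longleftrightarrow> False"
| "quantifier_free (Exists x A) \<longleftrightarrow> False"

record 'w frame =
  worlds :: "'w set"
  acc :: "('w \<times> 'w \<times> 'w) set"
  star :: "'w \<Rightarrow> 'w"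
  base :: 'w

text \<open>The star map is required to be extensional (\<open>undefined\<close> outside the set of worlds), so that
  equality of frames as records is equality of the set-theoretic structures
  \<open>\<langle>W, R, *, s\<rangle>\<close> and a set of frames carries no information about values of the star
  map outside \<open>W\<close>.\<close>

definition B_frame :: "'w frame \<Rightarrow> bool" where
  "B_frame F \<longleftrightarrow>
     (let W = worlds F; R = acc F; s = base F in
        W \<noteq> {} \<and> R \<subseteq> W \<times> W \<times> W \<and> star F \<in> W \<rightarrow>\<^sub>E W \<and> s \<in> W
      \<and> (\<forall>\<alpha>\<in>W. (s, \<alpha>, \<alpha>) \<in> R)
      \<and> (\<forall>\<alpha>\<in>W. \<forall>\<beta>\<in>W. \<forall>\<gamma>\<in>W. \<forall>\<delta>\<in>W.
           (s, \<alpha>, \<beta>) \<in> R \<and> (\<beta>, \<gamma>, \<delta>) \<in> R \<longrightarrow> (\<alpha>, \<gamma>, \<delta>) \<in> R)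
      \<and> (\<forall>\<alpha>\<in>W. star F (star F \<alpha>) = \<alpha>)
      \<and> (\<forall>\<alpha>\<in>W. \<forall>\<beta>\<in>W. (s, \<alpha>, \<beta>) \<in> R \<longrightarrow> (s, star F \<beta>, star F \<alpha>) \<in> R))"

definition RM_frame :: "'w frame \<Rightarrow> bool" where
  "RM_frame F \<longleftrightarrow> B_frame F \<and>
     (let W = worlds F; R = acc F; s = base F in
        (\<forall>\<alpha>\<in>W. \<forall>\<beta>\<in>W. \<forall>\<gamma>\<in>W. (\<alpha>, \<beta>, \<gamma>) \<in> R \<longrightarrow> (\<alpha>, star F \<gamma>, star F \<beta>) \<in> R)
      \<and> (\<forall>\<alpha>\<in>W. \<forall>\<beta>\<in>W. \<forall>\<gamma>\<in>W. (\<alpha>, \<beta>, \<gamma>) \<in> R \<longrightarrow> (\<beta>, \<alpha>, \<gamma>) \<in> R)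
      \<and> (\<forall>\<alpha>\<in>W. (\<alpha>, \<alpha>, \<alpha>) \<in> R)
      \<and> (\<forall>\<alpha>\<in>W. \<forall>\<beta>\<in>W. \<forall>\<gamma>\<in>W. \<forall>\<delta>\<in>W.
           (\<exists>x\<in>W. (\<alpha>, \<beta>, x) \<in> R \<and> (x, \<gamma>, \<delta>) \<in> R) \<longrightarrow>
           (\<exists>y\<in>W. (\<alpha>, y, \<delta>) \<in> R \<and> (\<beta>, \<gamma>, y) \<in> R))
      \<and> (\<forall>\<alpha>\<in>W. \<forall>\<beta>\<in>W. \<forall>\<gamma>\<in>W.
           (\<alpha>, \<beta>, \<gamma>) \<in> R \<longrightarrow> (s, \<alpha>, \<gamma>) \<in> R \<or> (s, \<beta>, \<gamma>) \<in> R))"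

definition between_B_RM :: "'w frame set \<Rightarrow> bool" where
  "between_B_RM L \<longleftrightarrow> (\<forall>F\<in>L. B_frame F) \<and> (\<forall>F. RM_frame F \<longrightarrow> F \<in> L)"

record ('w, 'd, 'f, 'p) model =
  frame_of :: "'w frame"
  carrier :: "'d set"
  fun_interp :: "'f \<Rightarrow> 'd list \<Rightarrow> 'd"
  valuation :: "'w \<Rightarrow> 'p \<Rightarrow> 'd list set"

definition B_model :: "('f, 'p) signature \<Rightarrow> ('w, 'd, 'f, 'p) model \<Rightarrow> bool" where
  "B_model S M \<longleftrightarrow>
     (let F = frame_of M; D = carrier M; V = valuation M in
        B_frame F \<and> D \<noteq> {}
      \<and> (\<forall>f ds. length ds = fun_arity S f \<and> set ds \<subseteq> D \<longrightarrow> fun_interp M f ds \<in> D)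
      \<and> (\<forall>w\<in>worlds F. \<forall>P. V w P \<subseteq> {ds. length ds = pred_arity S P \<and> set ds \<subseteq> D})
      \<and> (\<forall>\<alpha>\<in>worlds F. \<forall>\<beta>\<in>worlds F. \<forall>P. (base F, \<alpha>, \<beta>) \<in> acc F \<longrightarrow> V \<alpha> P \<subseteq> V \<beta> P))"

primrec tm_val :: "('w, 'd, 'f, 'p) model \<Rightarrow> (nat \<Rightarrow> 'd) \<Rightarrow> 'f tm \<Rightarrow> 'd" where
  "tm_val M a (Var x) = a x"
| "tm_val M a (App f ts) = fun_interp M f (map (tm_val M a) ts)"

primrec sat :: "('w, 'd, 'f, 'p) model \<Rightarrow> 'w \<Rightarrow> (nat \<Rightarrow> 'd) \<Rightarrow> ('f, 'p) fm \<Rightarrow> bool" where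
  "sat M w a (Pred P ts) \<longleftrightarrow> map (tm_val M a) ts \<in> valuation M w P"
| "sat M w a (Eql t u) \<longleftrightarrow> tm_val M a t = tm_val M a u"
| "sat M w a Top \<longleftrightarrow> True"
| "sat M w a Bot \<longleftrightarrow> False"
| "sat M w a (Neg A) \<longleftrightarrow> \<not> sat M (star (frame_of M) w) a A"
| "sat M w a (Conj A B) \<longleftrightarrow> sat M w a A \<and> sat M w a B"
| "sat M w a (Disj A B) \<longleftrightarrow> sat M w a A \<or> sat M w a B"
| "sat M w a (Imp A B) \<longleftrightarrow>
     (\<forall>w1 w2. (w, w1, w2) \<in> acc (frame_of M) \<longrightarrow> sat M w1 a A \<longrightarrow> sat M w2 a B)"
| "sat M w a (Forall x A) \<longleftrightarrow> (\<forall>d\<in>carrier M. sat M w (a(x := d)) A)"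
| "sat M w a (Exists x A) \<longleftrightarrow> (\<exists>d\<in>carrier M. sat M w (a(x := d)) A)"

definition holds_at :: "('w, 'd, 'f, 'p) model \<Rightarrow> 'w \<Rightarrow> ('f, 'p) fm \<Rightarrow> bool" where
  "holds_at M w A \<longleftrightarrow> (\<forall>a. range a \<subseteq> carrier M \<longrightarrow> sat M w a A)"

text \<open>A logic is given by a set \<open>L\<close> of frames whose worlds are drawn from the type \<open>'w\<close>; the
  type argument names the type \<open>'d\<close> from which the domains of the models are drawn. Both
  the set of worlds and the domain are arbitrary nonempty subsets of these types.\<close>

definition entails ::
  "'d itself \<Rightarrow> ('f, 'p) signature \<Rightarrow> 'w frame set \<Rightarrow> ('f, 'p) fm set \<Rightarrow> ('f, 'p) fm \<Rightarrow> bool" where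
  "entails _ S L \<Gamma> A \<longleftrightarrow>
     (\<forall>M :: ('w, 'd, 'f, 'p) model. B_model S M \<and> frame_of M \<in> L \<longrightarrow>
        (\<forall>G\<in>\<Gamma>. holds_at M (base (frame_of M)) G) \<longrightarrow> holds_at M (base (frame_of M)) A)"

datatype doag_fun = ZeroF | MinusF | PlusF

datatype doag_pred = LessP

definition doag_sig :: "(doag_fun, doag_pred) signature" where
  "doag_sig = \<lparr>fun_arity = (\<lambda>f. case f of ZeroF \<Rightarrow> 0 | MinusF \<Rightarrow> 1 | PlusF \<Rightarrow> 2),
               pred_arity = (\<lambda>P. case P of LessP \<Rightarrow> 2)\<rparr>"

abbreviation zero_tm :: "doag_fun tm" where
  "zero_tm \<equiv> App ZeroF []"

abbreviation minus_tm :: "doag_fun tm \<Rightarrow> doag_fun tm" where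
  "minus_tm t \<equiv> App MinusF [t]"

abbreviation plus_tm :: "doag_fun tm \<Rightarrow> doag_fun tm \<Rightarrow> doag_fun tm" where
  "plus_tm t u \<equiv> App PlusF [t, u]"

abbreviation less_fm :: "doag_fun tm \<Rightarrow> doag_fun tm \<Rightarrow> (doag_fun, doag_pred) fm" where
  "less_fm t u \<equiv> Pred LessP [t, u]"

text \<open>For \<open>n > 0\<close>, \<open>nfold_sum n t\<close> is the term \<open>(\<dots>(t + t) + \<dots>) + t\<close> with \<open>n\<close> occurrences
  of \<open>t\<close>.\<close>

definition nfold_sum :: "nat \<Rightarrow> doag_fun tm \<Rightarrow> doag_fun tm" where
  "nfold_sum n t = foldl plus_tm t (replicate (n - 1) t)"

definition DOAG :: "(doag_fun, doag_pred) fm set" where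
  "DOAG =
    (let x = Var 0; y = Var 1; z = Var 2;
         all_x = Forall 0; all_y = Forall 1; all_z = Forall 2; ex_x = Exists 0
     in
      {all_x (Imp (less_fm x x) Bot),
       all_x (all_y (Disj (Eql x y) (Disj (less_fm x y) (less_fm y x)))),
       all_x (all_y (all_z (Imp (Conj (less_fm x y) (less_fm y z)) (less_fm x z)))),
       all_x (all_y (all_z (Imp (less_fm x y) (less_fm (plus_tm x z) (plus_tm y z))))),
       all_x (all_y (all_z (Eql (plus_tm (plus_tm x y) z) (plus_tm x (plus_tm y z))))),
       all_x (Eql (plus_tm x zero_tm) x),
       all_x (Eql (plus_tm x (minus_tm x)) zero_tm),
       all_x (all_y (Eql (plus_tm x y) (plus_tm y x)))}
      \<union> {all_y (ex_x (Eql (nfold_sum n x) y)) | n. n > 1})"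

end

theory Submission
  imports Defs Complex_Main "HOL-Library.Countable"
begin

text \<open>
  Classically \<open>\<exists>x. 0 < x \<and> x < y\<close> reduces to \<open>0 < y\<close> because the order is dense. The axioms of DOAG
  force the order to be dense at the base world \<open>s\<close> only. Negation, however, looks at the world
  \<open>s*\<close>. Suppose that \<open>s*\<close> lies below \<open>s\<close>, in the sense that \<open>s\<close> relates \<open>s*\<close> to \<open>s\<close>. The axioms that
  are implications then bear on \<open>s*\<close> as well, but all they ask is that \<open><\<close> be irreflexive, transitive
  and translation-invariant there; the valuation must also be contained in the one at \<open>s\<close>. The
  totality axiom, being a disjunction, says nothing about \<open>s*\<close>.

  This freedom already exists in an \<open>\<^bold>R\<^bold>M\<close>-frame with two worlds, the frame of the three-valued
  logic \<open>\<^bold>R\<^bold>M\<^bold>3\<close>: its worlds are \<open>s\<close> and \<open>t = s*\<close>.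
  Over the rationals, let \<open>p < q\<close> have its usual meaning at \<open>s\<close>, and mean \<open>p + 1 < q\<close> at \<open>t\<close>. This
  is a model of DOAG (\<open>gap_model_DOAG\<close>), and at \<open>s\<close> the formula
  \<open>\<not> (\<exists>x. 0 < x \<and> x < y)\<close> says that \<open>0\<close> and \<open>y\<close> do not leave room for two successive steps longer
  than \<open>1\<close>, that is, \<open>y \<le> 2\<close> (\<open>sat_no_between\<close>).

  A quantifier-free formula cannot express this. If every variable denotes \<open>d\<close>, then every term
  denotes an integer multiple of \<open>d\<close>, and for \<open>d > 1\<close> the multiples of \<open>d\<close> are ordered in the same
  way, at either world, as their integer coefficients; hence no quantifier-free formula
  distinguishes one such \<open>d\<close> from another (\<open>quantifier_free_indiscernible\<close>). But \<open>2\<close> and \<open>3\<close> are on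
  different sides of the threshold.

  Since the frame is an \<open>\<^bold>R\<^bold>M\<close>-frame, it belongs to each logic between \<open>\<^bold>B\<close> and \<open>\<^bold>R\<^bold>M\<close>.
\<close>

section \<open>A frame with two worlds\<close>

text \<open>The only triple missing from the accessibility relation is the one that would make \<open>s\<close> lie
  below \<open>t\<close>; the worlds are thus strictly ordered, \<open>t\<close> below \<open>s\<close>, and the star map exchanges them.\<close>

definition RM3_frame :: "'w \<Rightarrow> 'w \<Rightarrow> 'w frame" where
  "RM3_frame s t =
     \<lparr>worlds = {s, t},
      acc = {s, t} \<times> {s, t} \<times> {s, t} - {(s, s, t)},
      star = (\<lambda>w. if w = s then t else if w = t then s else undefined),
      base = s\<rparr>"

lemma RM3_frame_sel [simp]:
  "worlds (RM3_frame s t) = {s, t}"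
  "acc (RM3_frame s t) = {s, t} \<times> {s, t} \<times> {s, t} - {(s, s, t)}"
  "star (RM3_frame s t) = (\<lambda>w. if w = s then t else if w = t then s else undefined)"
  "base (RM3_frame s t) = s"
  by (simp_all add: RM3_frame_def)

lemma B_frame_RM3: "s \<noteq> t \<Longrightarrow> B_frame (RM3_frame s t)"
  by (auto simp: B_frame_def Let_def split: if_splits)

lemma RM_frame_RM3: "s \<noteq> t \<Longrightarrow> RM_frame (RM3_frame s t)"
  by (auto simp: RM_frame_def B_frame_RM3 Let_def)

section \<open>The rationals with a wider order at the starred world\<close>

text \<open>The embedding \<open>e\<close> places a copy of the rationals into an arbitrary infinite type.\<close>

definition gap_model ::
  "'w \<Rightarrow> 'w \<Rightarrow> (rat \<Rightarrow> 'd) \<Rightarrow> ('w, 'd, doag_fun, doag_pred) model" where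
  "gap_model s t e =
     \<lparr>frame_of = RM3_frame s t,
      carrier = range e,
      fun_interp = (\<lambda>f ds. e (case f of
          ZeroF \<Rightarrow> 0
        | MinusF \<Rightarrow> - inv e (ds ! 0)
        | PlusF \<Rightarrow> inv e (ds ! 0) + inv e (ds ! 1))),
      valuation = (\<lambda>w P. {[e p, e q] | p q. p + (if w = s then 0 else 1) < q})\<rparr>"

lemma gap_model_sel [simp]:
  "frame_of (gap_model s t e) = RM3_frame s t"
  "carrier (gap_model s t e) = range e"
  by (simp_all add: gap_model_def)

lemma fun_interp_gap [simp]:
  assumes "inj e"
  shows "fun_interp (gap_model s t e) ZeroF [] = e 0"
    and "fun_interp (gap_model s t e) MinusF [e p] = e (- p)"
    and "fun_interp (gap_model s t e) PlusF [e p, e q] = e (p + q)"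
  using assms by (simp_all add: gap_model_def)

lemma valuation_gap [simp]:
  assumes "inj e"
  shows "[e p, e q] \<in> valuation (gap_model s t e) w P \<longleftrightarrow>
           p + (if w = s then 0 else 1) < q"
  using assms by (auto simp: gap_model_def inj_eq)

lemma B_model_gap:
  assumes "s \<noteq> t"
  shows "B_model doag_sig (gap_model s t e)"
proof -
  have "fun_interp (gap_model s t e) f ds \<in> range e" for f ds
    by (simp add: gap_model_def)
  moreover have "valuation (gap_model s t e) w P
      \<subseteq> {ds. length ds = pred_arity doag_sig P \<and> set ds \<subseteq> range e}" for w P
    by (cases P) (auto simp: gap_model_def doag_sig_def)
  moreover have "valuation (gap_model s t e) t P \<subseteq> valuation (gap_model s t e) s P" for P
    using assms by (force simp: gap_model_def)
  ultimately show ?thesis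
    using assms by (auto simp: B_model_def Let_def B_frame_RM3)
qed

lemma tm_val_nfold_sum_gap:
  assumes "inj e" and "n > 0" and "tm_val (gap_model s t e) a u = e p"
  shows "tm_val (gap_model s t e) a (nfold_sum n u) = e (of_nat n * p)"
proof -
  have "tm_val (gap_model s t e) a (foldl plus_tm v (replicate k u)) = e (q + of_nat k * p)"
    if "tm_val (gap_model s t e) a v = e q" for k v q
    using that
  proof (induction k arbitrary: v q)
    case (Suc k)
    have "tm_val (gap_model s t e) a (plus_tm v u) = e (q + p)"
      using Suc.prems assms by simp
    from Suc.IH[OF this] show ?case
      by (simp add: algebra_simps)
  qed simp
  from this[OF assms(3), of "n - 1"] show ?thesis
    using \<open>n > 0\<close> by (simp add: nfold_sum_def of_nat_diff algebra_simps)
qed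

text \<open>An implication is tested at pairs of worlds \<open>w1 \<le> w2\<close>. Besides the two worlds themselves, this
  includes the pair \<open>(t, s)\<close>, which is harmless because the order at \<open>t\<close> is contained in the one
  at \<open>s\<close>.\<close>

lemma gap_model_DOAG:
  assumes "s \<noteq> t" and "inj e" and "G \<in> DOAG"
  shows "holds_at (gap_model s t e) s G"
proof -
  let ?M = "gap_model s t e"
  have div: "sat ?M s a (Forall 1 (Exists 0 (Eql (nfold_sum n (Var 0)) (Var 1))))"
    if "n > 1" for n a
  proof -
    have "\<exists>p. tm_val ?M (a(1 := e q, 0 := e p)) (nfold_sum n (Var 0)) = e q" for q
    proof
      show "tm_val ?M (a(1 := e q, 0 := e (q / of_nat n))) (nfold_sum n (Var 0)) = e q"
        using \<open>inj e\<close> \<open>n > 1\<close> by (subst tm_val_nfold_sum_gap) auto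
    qed
    then show ?thesis by auto
  qed
  show ?thesis
    using assms div
    by (auto simp: DOAG_def holds_at_def Let_def inj_eq algebra_simps)
qed

section \<open>What formulas say about a single rational\<close>

lemma tm_val_const_gap:
  assumes "inj e" and "wf_tm doag_sig u"
  shows "\<exists>n::int. \<forall>d. tm_val (gap_model s t e) (\<lambda>_. e d) u = e (of_int n * d)"
  using assms(2)
proof (induction u)
  case (Var x)
  show ?case by (rule exI[of _ 1]) simp
next
  case (App f us)
  show ?case
  proof (cases f)
    case ZeroF
    then show ?thesis
      using App.prems \<open>inj e\<close> by (intro exI[of _ 0]) (auto simp: doag_sig_def)
  next
    case MinusF
    then obtain u where us: "us = [u]" and "wf_tm doag_sig u"
      using App.prems by (auto simp: doag_sig_def length_Suc_conv)
    with App.IH obtain n :: int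
      where "\<forall>d. tm_val (gap_model s t e) (\<lambda>_. e d) u = e (of_int n * d)"
      by auto
    then show ?thesis
      using us MinusF \<open>inj e\<close> by (intro exI[of _ "- n"]) simp
  next
    case PlusF
    then obtain u v where us: "us = [u, v]" and "wf_tm doag_sig u" "wf_tm doag_sig v"
      using App.prems by (auto simp: doag_sig_def length_Suc_conv numeral_2_eq_2)
    with App.IH obtain m n :: int
      where "\<forall>d. tm_val (gap_model s t e) (\<lambda>_. e d) u = e (of_int m * d)"
        and "\<forall>d. tm_val (gap_model s t e) (\<lambda>_. e d) v = e (of_int n * d)"
      by (metis list.set_intros)
    then show ?thesis
      using us PlusF \<open>inj e\<close> by (intro exI[of _ "m + n"]) (simp add: algebra_simps)
  qed
qed

text \<open>Distinct integer multiples of a number exceeding \<open>1\<close> are more than \<open>1\<close> apart, so on them the two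
  orders of the model coincide.\<close>

lemma int_multiple_gap_less_iff:
  fixes c d :: "'a::linordered_idom"
  assumes "0 \<le> c" and "c \<le> 1" and "1 < d"
  shows "of_int m * d + c < of_int n * d \<longleftrightarrow> m < n"
proof
  assume "m < n"
  then have "of_int (m + 1) \<le> (of_int n :: 'a)"
    unfolding of_int_le_iff by simp
  then have "of_int (m + 1) * d \<le> of_int n * d"
    using assms(3) by (intro mult_right_mono) simp_all
  then show "of_int m * d + c < of_int n * d"
    using assms(2,3) by (simp add: distrib_right)
next
  assume "of_int m * d + c < of_int n * d"
  then have "of_int m * d < of_int n * d"
    using assms(1) by linarith
  then show "m < n"
    using assms(3) by (simp add: mult_less_cancel_right)
qed

lemma quantifier_free_indiscernible:
  assumes "inj e" and "1 < d" and "1 < d'" and "wf_fm doag_sig B" and "quantifier_free B"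
  shows "sat (gap_model s t e) w (\<lambda>_. e d) B \<longleftrightarrow> sat (gap_model s t e) w (\<lambda>_. e d') B"
  using assms(4,5)
proof (induction B arbitrary: w)
  case (Pred P us)
  then obtain u v where us: "us = [u, v]" and "wf_tm doag_sig u" "wf_tm doag_sig v"
    by (cases P) (auto simp: doag_sig_def length_Suc_conv numeral_2_eq_2)
  then obtain m n :: int
    where "\<forall>d. tm_val (gap_model s t e) (\<lambda>_. e d) u = e (of_int m * d)"
      and "\<forall>d. tm_val (gap_model s t e) (\<lambda>_. e d) v = e (of_int n * d)"
    using tm_val_const_gap[OF \<open>inj e\<close>] by metis
  then show ?case
    using assms(1-3) us
      int_multiple_gap_less_iff[of "if w = s then 0 else 1" d m n]
      int_multiple_gap_less_iff[of "if w = s then 0 else 1" d' m n]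
    by simp
next
  case (Eql u v)
  then obtain m n :: int
    where "\<forall>d. tm_val (gap_model s t e) (\<lambda>_. e d) u = e (of_int m * d)"
      and "\<forall>d. tm_val (gap_model s t e) (\<lambda>_. e d) v = e (of_int n * d)"
    using tm_val_const_gap[OF \<open>inj e\<close>] by (metis wf_fm.simps(2))
  then show ?case
    using assms(1-3) by (simp add: inj_eq)
qed simp_all

text \<open>The negation moves the evaluation to \<open>t\<close>, where an element between \<open>0\<close> and \<open>d\<close> has to be more
  than \<open>1\<close> away from both. There is one if and only if \<open>d > 2\<close>.\<close>

lemma sat_no_between:
  assumes "s \<noteq> t" and "inj e"
  shows "sat (gap_model s t e) s (\<lambda>_. e d)
           (Neg (Exists 0 (Conj (less_fm zero_tm (Var 0)) (less_fm (Var 0) (Var 1))))) \<longleftrightarrow>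
         d \<le> 2"
proof -
  have "(\<exists>p. 1 < p \<and> p + 1 < d) \<longleftrightarrow> 2 < d"
  proof
    assume "2 < d"
    then have "1 < d / 2 \<and> d / 2 + 1 < d"
      by (simp add: field_simps)
    then show "\<exists>p. 1 < p \<and> p + 1 < d" ..
  qed auto
  then show ?thesis
    using assms by auto
qed

lemma sat_Iff_imp_iff:
  assumes "sat M w a (Iff A B)" and "(w, w, w) \<in> acc (frame_of M)"
  shows "sat M w a A \<longleftrightarrow> sat M w a B"
  using assms by (auto simp: Iff_def)

theorem theorem10:
  fixes L :: "'w::infinite frame set"
  assumes "between_B_RM L"
  shows "\<exists>A. wf_fm doag_sig A \<and>
           \<not> (\<exists>B. wf_fm doag_sig B \<and> quantifier_free B \<and>
                  entails TYPE('d::infinite) doag_sig L DOAG (Iff A B))"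
proof -
  obtain s t :: 'w where "s \<noteq> t"
    using ex_new_if_finite[OF infinite_UNIV, of "{undefined :: 'w}"] by auto
  obtain g :: "nat \<Rightarrow> 'd" where "inj g"
    using infinite_countable_subset[OF infinite_UNIV] by blast
  define e :: "rat \<Rightarrow> 'd" where "e = g \<circ> to_nat"
  have "inj e"
    using \<open>inj g\<close> by (simp add: e_def inj_compose)
  let ?M = "gap_model s t e"
  let ?A = "Neg (Exists 0 (Conj (less_fm zero_tm (Var 0)) (less_fm (Var 0) (Var 1))))"
  have "frame_of ?M \<in> L"
    using assms RM_frame_RM3[OF \<open>s \<noteq> t\<close>] by (simp add: between_B_RM_def)
  have False
    if B: "wf_fm doag_sig B" "quantifier_free B"
      and "entails TYPE('d) doag_sig L DOAG (Iff ?A B)" for B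
  proof -
    have "holds_at ?M s (Iff ?A B)"
      using that(3) \<open>frame_of ?M \<in> L\<close> B_model_gap[OF \<open>s \<noteq> t\<close>, of e]
        gap_model_DOAG[OF \<open>s \<noteq> t\<close> \<open>inj e\<close>]
      unfolding entails_def by fastforce
    then have "sat ?M s (\<lambda>_. e d) (Iff ?A B)" for d
      by (auto simp: holds_at_def)
    then have "sat ?M s (\<lambda>_. e d) ?A \<longleftrightarrow> sat ?M s (\<lambda>_. e d) B" for d
      by (rule sat_Iff_imp_iff) (use \<open>s \<noteq> t\<close> in simp)
    then have "sat ?M s (\<lambda>_. e d) B \<longleftrightarrow> d \<le> 2" for d
      using sat_no_between[OF \<open>s \<noteq> t\<close> \<open>inj e\<close>] by blast
    then show False
      using quantifier_free_indiscernible[OF \<open>inj e\<close> _ _ B, of 2 3 s t s] by simp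
  qed
  moreover have "wf_fm doag_sig ?A"
    by (simp add: doag_sig_def)
  ultimately show ?thesis
    by blast
qed

end
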